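(* Let $p$ and $q$ be primes such that $q\equiv 1\pmod p$. Then the nonabelian group of order $pq$ is generalized Schur.
   Context: All groups are finite. For a group $G$ with identity $e$ and $X\subseteq G$, write $\underline{X}=\sum_{x\in X}x\in\mathbb{Z}G$ and $X^{-1}=\{x^{-1}:x\in X\}$. A subring $\mathcal{A}\subseteq\mathbb{Z}G$ is an $S$-ring over $G$ if there is a partition $\mathcal{S}(\mathcal{A})$ of $G$ such that $\{e\}\in\mathcal{S}(\mathcal{A})$; $X\in\mathcal{S}(\mathcal{A})$ implies $X^{-1}\in\mathcal{S}(\mathcal{A})$; and $\mathcal{A}=\mathrm{Span}_{\mathbb{Z}}\{\underline{X}:X\in\mathcal{S}(\mathcal{A})\}$. The $S$-ring $\mathcal{A}$ is schurian if there is a subgroup $K\leq\mathrm{Sym}(G)$ containing all right translations of $G$ such that $\mathcal{S}(\mathcal{A})$ is the set of orbits on $G$ of the stabilizer $K_e$ of $e$ in $K$. The $S$-ring $\mathcal{A}$ is central if $\mathcal{A}\subseteq Z(\mathbb{Z}G)$, equivalently if every $X\in\mathcal{S}(\mathcal{A})$ is a union of conjugacy classes of $G$. A group $G$ is generalized Schur if every central $S$-ring over $G$ is schurian. *)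

theory Defs
  imports
    "HOL-Algebra.Subrings"
    "HOL-Algebra.Group_Action"
    "HOL-Number_Theory.Cong"
    "HOL-Library.Indicator_Function"
begin

text \<open>
  All notions below are meant for finite groups, which is assumed where they are used. An element
  of the integral group ring is represented by its coefficient function, taken to be zero outside
  the carrier; the product is convolution. In particular the simple quantity of a subset
  \<open>X\<close> is the function \<open>indicator X\<close>.
\<close>

definition group_ring :: "('a, 'b) monoid_scheme \<Rightarrow> ('a \<Rightarrow> int) ring" where
  "group_ring G =
    \<lparr>carrier = {f. \<forall>x. x \<notin> carrier G \<longrightarrow> f x = 0},
     monoid.mult = (\<lambda>f g x. \<Sum>(y, z) \<in> {(y, z). y \<in> carrier G \<and> z \<in> carrier G \<and> y \<otimes>\<^bsub>G\<^esub> z = x}. f y * g z),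
     one = indicator {\<one>\<^bsub>G\<^esub>},
     zero = (\<lambda>x. 0),
     add = (\<lambda>f g x. f x + g x)\<rparr>"

definition int_span :: "('a \<Rightarrow> int) set \<Rightarrow> ('a \<Rightarrow> int) set" where
  "int_span B = {(\<lambda>x. \<Sum>f\<in>B. c f * f x) | c. True}"

definition ring_center :: "('a, 'b) ring_scheme \<Rightarrow> 'a set" where
  "ring_center R = {x \<in> carrier R. \<forall>y \<in> carrier R. x \<otimes>\<^bsub>R\<^esub> y = y \<otimes>\<^bsub>R\<^esub> x}"

definition basic_sets :: "('a, 'b) monoid_scheme \<Rightarrow> ('a \<Rightarrow> int) set \<Rightarrow> 'a set set \<Rightarrow> bool" where
  "basic_sets G A S \<longleftrightarrow>
     partition_on (carrier G) S \<and>
     {\<one>\<^bsub>G\<^esub>} \<in> S \<and>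
     (\<forall>X \<in> S. (\<lambda>x. inv\<^bsub>G\<^esub> x) ` X \<in> S) \<and>
     A = int_span (indicator ` S)"

definition S_ring :: "('a, 'b) monoid_scheme \<Rightarrow> ('a \<Rightarrow> int) set \<Rightarrow> bool" where
  "S_ring G A \<longleftrightarrow> subring A (group_ring G) \<and> (\<exists>S. basic_sets G A S)"

text \<open>
  The partition of an S-ring is unique: its cells are the classes of points that no element of the
  ring separates. So the existential quantifier over \<open>S\<close> below just names it.
  The symmetric group is \<^const>\<open>BijGroup\<close>, whose elements are extensional functions;
  hence the bounded abstraction in the right translations.
\<close>

definition schurian :: "('a, 'b) monoid_scheme \<Rightarrow> ('a \<Rightarrow> int) set \<Rightarrow> bool" where
  "schurian G A \<longleftrightarrow>
     (\<exists>S K. basic_sets G A S \<and>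
        subgroup K (BijGroup (carrier G)) \<and>
        (\<forall>g \<in> carrier G. (\<lambda>x \<in> carrier G. x \<otimes>\<^bsub>G\<^esub> g) \<in> K) \<and>
        S = orbits
              (BijGroup (carrier G)
                \<lparr>carrier := stabilizer (BijGroup (carrier G)\<lparr>carrier := K\<rparr>) (\<lambda>f. f) \<one>\<^bsub>G\<^esub>\<rparr>)
              (carrier G) (\<lambda>f. f))"

definition central_S_ring :: "('a, 'b) monoid_scheme \<Rightarrow> ('a \<Rightarrow> int) set \<Rightarrow> bool" where
  "central_S_ring G A \<longleftrightarrow> S_ring G A \<and> A \<subseteq> ring_center (group_ring G)"

definition generalized_Schur :: "('a, 'b) monoid_scheme \<Rightarrow> bool" where
  "generalized_Schur G \<longleftrightarrow> (\<forall>A. central_S_ring G A \<longrightarrow> schurian G A)"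

end

(*
  The power maps x \<mapsto> x^m with m coprime to |G| permute the basic sets of a central S-ring (Schur's
  theorem on multipliers): for a prime r, the coefficients of the r-th power of a basic set X are
  congruent modulo r to those of {x^r : x in X}, because rotation acts on r-tuples with product in a
  given conjugacy class.

  Let N be the normal subgroup of order q. The conjugacy class of y outside N is the coset Ny, and y
  has order p. If a nontrivial element of N is equivalent to an element outside N, independent
  powers modulo p and q make all nontrivial elements equivalent, and Sym(G) does the job. Otherwise
  the maps n z^i \<mapsto> n^k z'^i, with z equivalent to z' and n^k to n, are automorphisms of the Cayley
  scheme that act transitively on each basic set.
*)
theory Submission
  imports Defs "HOL-Number_Theory.Residues" "HOL-Algebra.Sylow"
begin

section \<open>Fixed points of a map of prime period\<close>

text \<open>The iterates of \<open>f\<close> give an action of a cyclic group of order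
  \<open>r\<close>, so every orbit has 1 or \<open>r\<close> points. The induction strips off one
  orbit of size \<open>r\<close> at a time until only fixed points remain.\<close>

lemma card_cong_card_fixpoints:
  fixes f :: "'a \<Rightarrow> 'a"
  assumes "finite T" and "prime r"
    and "\<And>x. x \<in> T \<Longrightarrow> f x \<in> T" and "\<And>x. x \<in> T \<Longrightarrow> (f ^^ r) x = x"
  shows "[card T = card {x \<in> T. f x = x}] (mod r)"
  using assms(1,3,4)
proof (induction T rule: finite_psubset_induct)
  case (psubset T)
  note closed = psubset.prems(1) and period = psubset.prems(2)
  have "r > 0" using \<open>prime r\<close> by (simp add: prime_gt_0_nat)
  show ?case
  proof (cases "\<forall>x\<in>T. f x = x")
    case True
    then have "{x \<in> T. f x = x} = T" by auto
    then show ?thesis by simp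
  next
    case False
    then obtain x where x: "x \<in> T" "f x \<noteq> x" by blast
    have fx: "(f ^^ r) x = x" using period x by blast
    have reduce: "(f ^^ n) x = (f ^^ (n mod r)) x" for n
      using funpow_mod_eq[OF fx] by metis
    \<comment> \<open>The orbit of the moved point \<open>x\<close>. It turns out to have
      \<open>r\<close> points, none of them fixed, and a complement closed under \<open>f\<close>,
      so the induction hypothesis applies to \<open>T - O'\<close>.\<close>
    define O' where "O' = (\<lambda>i. (f ^^ i) x) ` {..<r}"
    have in_O: "(f ^^ n) x \<in> O'" for n
      unfolding O'_def using reduce[of n] \<open>r > 0\<close> by auto
    have in_T: "(f ^^ n) x \<in> T" for n
      by (induction n) (use x closed in auto)
    have O_sub: "O' \<subseteq> T" unfolding O'_def using in_T by auto
    have neq: "(f ^^ i) x \<noteq> (f ^^ j) x" if "i < j" "j < r" for i j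
    proof
      assume eq: "(f ^^ i) x = (f ^^ j) x"
      define d where "d = j - i"
      have "(f ^^ r) x = (f ^^ (r - i)) ((f ^^ i) x)"
        using that by (simp flip: funpow_add[THEN fun_cong, unfolded o_apply])
      also have "\<dots> = (f ^^ (r - i + j)) x"
        by (simp add: eq funpow_add)
      also have "r - i + j = d + r" using that by (simp add: d_def)
      also have "(f ^^ (d + r)) x = (f ^^ d) x" by (simp add: funpow_add fx)
      finally have fd: "(f ^^ d) x = x" using fx by simp
      have "0 < d" "d < r" using that by (auto simp: d_def)
      then have "coprime d r"
        using \<open>prime r\<close> by (metis coprime_commute nat_dvd_not_less prime_imp_coprime)
      \<comment> \<open>A coincidence of iterates gives \<open>x\<close> a period \<open>d\<close>
        coprime to \<open>r\<close>; Bezout combines the periods \<open>d\<close> and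
        \<open>r\<close> into the period 1, against the choice of \<open>x\<close>.\<close>
      then obtain a b where ab: "d * a = r * b + 1"
        using bezout_nat[of d r] \<open>0 < d\<close> by (metis coprime_imp_gcd_eq_1 not_gr_zero)
      have "(f ^^ (d * a)) x = x"
        using funpow_mod_eq[OF fd, of "d * a"] by simp
      moreover have "(f ^^ (r * b + 1)) x = f x"
        using funpow_mod_eq[OF fx, of "r * b"] by simp
      ultimately show False using ab x(2) by simp
    qed
    have "inj_on (\<lambda>i. (f ^^ i) x) {..<r}"
      by (rule linorder_inj_onI) (use neq in auto)
    then have card_O: "card O' = r" by (simp add: O'_def card_image)
    have closed': "f y \<in> T - O'" if "y \<in> T - O'" for y
    proof -
      have "f y \<notin> O'"
      proof
        assume "f y \<in> O'"
        then obtain i where i: "f y = (f ^^ i) x" unfolding O'_def by auto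
        \<comment> \<open>On \<open>T\<close> the map \<open>f\<close> is undone by
          \<open>f ^^ (r - 1)\<close>, so a point sent into the orbit already lies in it.\<close>
        have "y = (f ^^ (Suc (r - 1))) y" using period[of y] that \<open>r > 0\<close> by simp
        also have "\<dots> = (f ^^ (r - 1)) (f y)" by (simp only: funpow_Suc_right o_apply)
        also have "\<dots> = (f ^^ (r - 1 + i)) x" by (simp add: i funpow_add)
        finally show False using in_O[of "r - 1 + i"] that by auto
      qed
      then show ?thesis using closed that by auto
    qed
    have notfix: "f y \<noteq> y" if "y \<in> O'" for y
    proof
      assume "f y = y"
      obtain i where i: "i < r" "y = (f ^^ i) x" using \<open>y \<in> O'\<close> unfolding O'_def by auto
      have "x = (f ^^ (r - i)) y" using i fx
        by (simp flip: funpow_add[THEN fun_cong, unfolded o_apply])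
      also have "(f ^^ n) y = y" for n by (induction n) (auto simp: \<open>f y = y\<close>)
      finally show False using x(2) \<open>f y = y\<close> by simp
    qed
    have fixeq: "{y \<in> T. f y = y} = {y \<in> T - O'. f y = y}" using notfix by auto
    have "T - O' \<subset> T" using x(1) in_O[of 0] by auto
    then have "[card (T - O') = card {y \<in> T - O'. f y = y}] (mod r)"
      using psubset.IH[of "T - O'"] closed' period by blast
    moreover have "card T = card (T - O') + r"
      using card_O O_sub psubset.hyps
      by (metis card_Diff_subset card_mono finite_subset le_add_diff_inverse2)
    ultimately show ?thesis unfolding fixeq by (simp add: cong_def)
  qed
qed

section \<open>Basic sets of a central S-ring as equivalence classes\<close>

locale central_S_ring_partition = group G for G (structure) +
  fixes A :: "('a \<Rightarrow> int) set" and S :: "'a set set"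
  assumes finite_carrier: "finite (carrier G)"
    and subring: "subring A (group_ring G)"
    and basic: "basic_sets G A S"
    and central: "A \<subseteq> ring_center (group_ring G)"
begin

definition eqv (infix \<open>\<sim>\<close> 50) where "x \<sim> y \<longleftrightarrow> (\<exists>X\<in>S. x \<in> X \<and> y \<in> X)"

lemma partition: "partition_on (carrier G) S"
  using basic by (simp add: basic_sets_def)

lemma basic_set_unique: "X \<in> S \<Longrightarrow> Y \<in> S \<Longrightarrow> x \<in> X \<Longrightarrow> x \<in> Y \<Longrightarrow> X = Y"
  using partition unfolding partition_on_def disjoint_def by (metis disjoint_iff)

lemma eqv_refl: "x \<in> carrier G \<Longrightarrow> x \<sim> x"
  using partition by (auto simp: eqv_def partition_on_def)

lemma eqv_sym: "x \<sim> y \<Longrightarrow> y \<sim> x"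
  by (auto simp: eqv_def)

lemma eqv_trans: "x \<sim> y \<Longrightarrow> y \<sim> z \<Longrightarrow> x \<sim> z"
  using basic_set_unique unfolding eqv_def by metis

lemma eqv_carrier: "x \<sim> y \<Longrightarrow> x \<in> carrier G \<and> y \<in> carrier G"
  using partition_onD1[OF partition] unfolding eqv_def by blast

lemma eqv_one: "x \<sim> \<one> \<longleftrightarrow> x = \<one>"
proof
  assume "x \<sim> \<one>"
  then obtain X where X: "X \<in> S" "x \<in> X" "\<one> \<in> X" by (auto simp: eqv_def)
  moreover have "{\<one>} \<in> S" using basic by (simp add: basic_sets_def)
  ultimately show "x = \<one>" using basic_set_unique by blast
qed (simp add: eqv_refl)

lemma basic_set_eq: "X \<in> S \<Longrightarrow> x \<in> X \<Longrightarrow> X = {y. x \<sim> y}"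
  using basic_set_unique unfolding eqv_def by blast

lemma finite_S: "finite S"
  using partition finite_carrier by (meson finite_elements)

text \<open>Ring elements are integer combinations of indicators of basic sets, and each indicator
  is constant on every basic set.\<close>

lemma eqv_imp_eq:
  assumes "a \<in> A" and "x \<sim> y" shows "a x = a y"
proof -
  obtain c where c: "a = (\<lambda>x. \<Sum>f\<in>indicator ` S. c f * f x)"
    using assms(1) basic by (auto simp: basic_sets_def int_span_def)
  have "(indicator X :: 'a \<Rightarrow> int) x = indicator X y" if "X \<in> S" for X
    using basic_set_unique[OF that] assms(2) unfolding eqv_def by (metis indicator_simps)
  then show ?thesis unfolding c by (intro sum.cong) auto
qed

lemma indicator_in_ring:
  assumes "X \<in> S" shows "indicator X \<in> A"
proof -
  have "(indicator X :: 'a \<Rightarrow> int) =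
    (\<lambda>x. \<Sum>f\<in>indicator ` S. (if f = indicator X then 1 else 0) * f x)"
    using assms finite_S by (auto simp: if_distrib[of "\<lambda>c. c * _"] sum.delta' cong: if_cong)
  then show ?thesis
    using basic unfolding basic_sets_def int_span_def by auto
qed

text \<open>Centrality is tested against the group element \<open>h\<close>, viewed as the ring
  element \<open>d\<close>. At the point \<open>g \<otimes> h\<close> each of the two products
  reduces to a single summand, namely \<open>a g\<close> and
  \<open>a (inv h \<otimes> g \<otimes> h)\<close>.\<close>

lemma ring_element_conj:
  assumes "a \<in> A" "g \<in> carrier G" "h \<in> carrier G"
  shows "a (inv h \<otimes> g \<otimes> h) = a g"
proof -
  define d :: "'a \<Rightarrow> int" where "d = indicator {h}"
  have "d \<in> carrier (group_ring G)" using assms by (auto simp: d_def group_ring_def indicator_def)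
  then have comm: "a \<otimes>\<^bsub>group_ring G\<^esub> d = d \<otimes>\<^bsub>group_ring G\<^esub> a"
    using central assms(1) by (auto simp: ring_center_def)
  let ?P = "{(y, z). y \<in> carrier G \<and> z \<in> carrier G \<and> y \<otimes> z = g \<otimes> h}"
  have fin: "finite ?P"
    by (rule finite_subset[of _ "carrier G \<times> carrier G"]) (auto simp: finite_carrier)
  have "(a \<otimes>\<^bsub>group_ring G\<^esub> d) (g \<otimes> h) = (\<Sum>(y, z)\<in>?P. a y * d z)"
    by (simp add: group_ring_def)
  also have "\<dots> = (\<Sum>(y, z)\<in>{(g, h)}. a y * d z)"
    by (rule sum.mono_neutral_right[OF fin])
       (use assms in \<open>auto simp: d_def indicator_def split: if_splits\<close>)
  finally have 1: "(a \<otimes>\<^bsub>group_ring G\<^esub> d) (g \<otimes> h) = a g" by (simp add: d_def)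
  have "(d \<otimes>\<^bsub>group_ring G\<^esub> a) (g \<otimes> h) = (\<Sum>(y, z)\<in>?P. d y * a z)"
    by (simp add: group_ring_def)
  also have "\<dots> = (\<Sum>(y, z)\<in>{(h, inv h \<otimes> g \<otimes> h)}. d y * a z)"
  proof (rule sum.mono_neutral_right[OF fin])
    show "{(h, inv h \<otimes> g \<otimes> h)} \<subseteq> ?P" using assms by (simp add: m_assoc[symmetric])
    have "z = inv h \<otimes> g \<otimes> h" if "z \<in> carrier G" "h \<otimes> z = g \<otimes> h" for z
      using that assms by (metis inv_closed inv_solve_left m_assoc m_closed)
    then show "\<forall>i\<in>?P - {(h, inv h \<otimes> g \<otimes> h)}. (case i of (y, z) \<Rightarrow> d y * a z) = 0"
      by (auto simp: d_def indicator_def)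
  qed
  finally have 2: "(d \<otimes>\<^bsub>group_ring G\<^esub> a) (g \<otimes> h) = a (inv h \<otimes> g \<otimes> h)" by (simp add: d_def)
  from 1 2 comm show ?thesis by simp
qed

lemma eqv_conj:
  assumes "g \<in> carrier G" "h \<in> carrier G"
  shows "inv h \<otimes> g \<otimes> h \<sim> g"
proof -
  obtain X where X: "X \<in> S" "g \<in> X" using eqv_refl[OF assms(1)] by (auto simp: eqv_def)
  have "(indicator X :: 'a \<Rightarrow> int) (inv h \<otimes> g \<otimes> h) = 1"
    using ring_element_conj[OF indicator_in_ring[OF X(1)] assms] X(2) by simp
  then show ?thesis using X by (auto simp: eqv_def indicator_def split: if_splits)
qed

section \<open>Counting tuples with a given product\<close>

definition list_prod :: "'a list \<Rightarrow> 'a" where "list_prod xs = foldr (\<otimes>) xs \<one>"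

text \<open>For \<open>X\<close> inside the carrier, the size of this set is the coefficient of
  \<open>g\<close> in the \<open>n\<close>-th power of the simple quantity of
  \<open>X\<close>.\<close>

definition tuples :: "'a set \<Rightarrow> nat \<Rightarrow> 'a \<Rightarrow> 'a list set" where
  "tuples X n g = {xs. length xs = n \<and> set xs \<subseteq> X \<and> list_prod xs = g}"

lemma list_prod_closed: "set xs \<subseteq> carrier G \<Longrightarrow> list_prod xs \<in> carrier G"
  by (induction xs) (auto simp: list_prod_def)

lemma list_prod_append:
  "set xs \<subseteq> carrier G \<Longrightarrow> set ys \<subseteq> carrier G \<Longrightarrow> list_prod (xs @ ys) = list_prod xs \<otimes> list_prod ys"
proof (induction xs)
  case Nil
  then show ?case using list_prod_closed[of ys] by (simp add: list_prod_def)
next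
  case (Cons x xs)
  then show ?case using list_prod_closed[of xs] list_prod_closed[of ys]
    by (auto simp: list_prod_def m_assoc)
qed

lemma list_prod_Cons: "list_prod (x # xs) = x \<otimes> list_prod xs"
  by (simp add: list_prod_def)

lemma list_prod_replicate: "x \<in> carrier G \<Longrightarrow> list_prod (replicate n x) = x [^] n"
proof (induction n)
  case (Suc n)
  then show ?case by (simp add: list_prod_Cons nat_pow_comm[of x n 1, simplified])
qed (simp add: list_prod_def)

lemma finite_tuples: "X \<subseteq> carrier G \<Longrightarrow> finite (tuples X n g)"
  by (rule finite_subset[OF _ finite_lists_length_eq[of X n]])
     (auto simp: tuples_def intro: finite_subset[OF _ finite_carrier])

text \<open>Splitting off the first entry of a tuple is convolution with \<open>indicator X\<close>,
  so the counts form a power of a ring element. By \<open>eqv_imp_eq\<close> they are therefore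
  constant on basic sets.\<close>

lemma card_tuples_in_ring:
  assumes "X \<in> S"
  shows "(\<lambda>g. int (card (tuples X n g))) \<in> A"
proof (induction n)
  case 0
  have "(\<lambda>g. int (card (tuples X 0 g))) = \<one>\<^bsub>group_ring G\<^esub>"
  proof
    fix g
    have "tuples X 0 g = (if g = \<one> then {[]} else {})"
      by (auto simp: tuples_def list_prod_def)
    then show "int (card (tuples X 0 g)) = \<one>\<^bsub>group_ring G\<^esub> g"
      by (simp add: group_ring_def)
  qed
  then show ?case using subringE(3)[OF subring] by simp
next
  case (Suc n)
  have X: "X \<subseteq> carrier G" using assms partition by (auto simp: partition_on_def)
  have "(\<lambda>g. int (card (tuples X (Suc n) g))) =
    indicator X \<otimes>\<^bsub>group_ring G\<^esub> (\<lambda>g. int (card (tuples X n g)))" (is "_ = ?R")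
  proof
    fix g
    let ?P = "{(y, z). y \<in> carrier G \<and> z \<in> carrier G \<and> y \<otimes> z = g}"
    let ?Q = "{(y, z). y \<in> X \<and> z \<in> carrier G \<and> y \<otimes> z = g}"
    have fin: "finite ?P"
      by (rule finite_subset[of _ "carrier G \<times> carrier G"]) (auto simp: finite_carrier)
    have sub: "?Q \<subseteq> ?P" using X by auto
    have dec: "tuples X (Suc n) g = (\<Union>i\<in>?Q. (#) (fst i) ` tuples X n (snd i))"
    proof (intro equalityI subsetI)
      fix xs assume "xs \<in> tuples X (Suc n) g"
      then obtain y ys where xs: "xs = y # ys" "length ys = n" "y \<in> X" "set ys \<subseteq> X"
          "y \<otimes> list_prod ys = g"
        by (auto simp: tuples_def length_Suc_conv list_prod_Cons)
      then have "(y, list_prod ys) \<in> ?Q" "ys \<in> tuples X n (list_prod ys)"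
        using list_prod_closed[of ys] X by (auto simp: tuples_def)
      then show "xs \<in> (\<Union>i\<in>?Q. (#) (fst i) ` tuples X n (snd i))"
        using xs(1) by (intro UN_I[of "(y, list_prod ys)"]) auto
    qed (auto simp: tuples_def list_prod_Cons)
    have "card (tuples X (Suc n) g) = (\<Sum>i\<in>?Q. card ((#) (fst i) ` tuples X n (snd i)))"
      unfolding dec
    proof (rule card_UN_disjoint)
      show "finite ?Q" using fin sub by (rule rev_finite_subset)
      show "\<forall>i\<in>?Q. finite ((#) (fst i) ` tuples X n (snd i))" by (simp add: finite_tuples[OF X])
      show "\<forall>i\<in>?Q. \<forall>j\<in>?Q. i \<noteq> j \<longrightarrow>
          (#) (fst i) ` tuples X n (snd i) \<inter> (#) (fst j) ` tuples X n (snd j) = {}"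
        by (auto simp: tuples_def)
    qed
    also have "\<dots> = (\<Sum>(y, z)\<in>?Q. card (tuples X n z))"
      by (simp add: card_image split_def)
    also have "int \<dots> = (\<Sum>(y, z)\<in>?Q. indicator X y * int (card (tuples X n z)))"
      by (auto intro!: sum.cong)
    also have "\<dots> = (\<Sum>(y, z)\<in>?P. indicator X y * int (card (tuples X n z)))"
      by (rule sum.mono_neutral_left[OF fin sub]) (auto simp: indicator_def)
    also have "\<dots> = ?R g" by (simp add: group_ring_def)
    finally show "int (card (tuples X (Suc n) g)) = ?R g" .
  qed
  then show ?case using subringE(6)[OF subring indicator_in_ring[OF assms] Suc.IH] by simp
qed

end

section \<open>Rotations, powers and conjugacy classes\<close>

lemma nth_eq_hd_if_rotate1_fixed:
  assumes "rotate1 xs = xs" "i < length xs" shows "xs ! i = hd xs"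
  using assms(2)
proof (induction i)
  case 0
  then show ?case by (simp add: hd_conv_nth)
next
  case (Suc i)
  have "xs ! Suc i = rotate1 xs ! i" using Suc.prems by (simp add: nth_rotate1)
  then show ?case using Suc assms(1) by simp
qed

context group
begin

lemma pow_cong:
  assumes "x \<in> carrier G" "x [^] n = \<one>" "[i = j] (mod n)"
  shows "x [^] i = x [^] (j::nat)"
proof -
  have "x [^] k = x [^] (k mod n)" for k
  proof -
    have "x [^] k = x [^] (n * (k div n) + k mod n)" by simp
    also have "\<dots> = (x [^] n) [^] (k div n) \<otimes> x [^] (k mod n)"
      using assms(1) by (simp only: nat_pow_mult nat_pow_pow)
    finally show ?thesis using assms by simp
  qed
  then show ?thesis using assms(3) unfolding cong_def by metis
qed

text \<open>If \<open>k\<close> inverts \<open>m\<close> modulo the group order, then raising to the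
  power \<open>k\<close> undoes raising to the power \<open>m\<close>.\<close>

lemma pow_inj_coprime:
  assumes "coprime m (order G)" "x \<in> carrier G" "y \<in> carrier G" "x [^] m = y [^] (m::nat)"
  shows "x = y"
proof -
  obtain k where "[m * k = 1] (mod order G)" using cong_solve_coprime_nat assms(1) by auto
  then have "z = (z [^] m) [^] k" if "z \<in> carrier G" for z
    using pow_cong[OF that pow_order_eq_1[OF that], of "m * k" 1] that by (simp add: nat_pow_pow)
  then show ?thesis using assms by metis
qed

lemma conj_pow:
  assumes "g \<in> carrier G" "h \<in> carrier G"
  shows "(h \<otimes> g \<otimes> inv h) [^] (n::nat) = h \<otimes> g [^] n \<otimes> inv h"
proof (induction n)
  case (Suc n)
  have "h \<otimes> g [^] n \<otimes> inv h \<otimes> (h \<otimes> g \<otimes> inv h) = h \<otimes> g [^] n \<otimes> (inv h \<otimes> h) \<otimes> g \<otimes> inv h"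
    using assms by (simp only: m_assoc[symmetric] m_closed inv_closed nat_pow_closed)
  then show ?case using Suc assms by (simp add: m_assoc)
qed (use assms in simp)

definition conj_class :: "'a \<Rightarrow> 'a set" where
  "conj_class g = (\<lambda>h. h \<otimes> g \<otimes> inv h) ` carrier G"

text \<open>Orbit-stabilizer for the conjugation action. It makes class sizes invertible modulo
  every prime coprime to the group order.\<close>

lemma card_conj_class_dvd_order:
  assumes "g \<in> carrier G" shows "card (conj_class g) dvd order G"
proof -
  have "conj_class g = orbit G (\<lambda>g. \<lambda>h \<in> carrier G. g \<otimes> h \<otimes> inv g) g"
    using assms by (simp add: conj_class_def orbit_def Setcompr_eq_image)
  then show ?thesis
    using group_action.orbit_stabilizer_theorem[OF action_by_conjugation assms]
    by (simp add: dvdI[OF sym])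
qed

lemma conj_class_inv_conj:
  assumes "g \<in> carrier G" "c \<in> conj_class g" "x \<in> carrier G"
  shows "inv x \<otimes> c \<otimes> x \<in> conj_class g"
proof -
  obtain h where h: "h \<in> carrier G" "c = h \<otimes> g \<otimes> inv h" using assms by (auto simp: conj_class_def)
  then have "inv x \<otimes> c \<otimes> x = (inv x \<otimes> h) \<otimes> g \<otimes> inv (inv x \<otimes> h)"
    using assms by (simp add: inv_mult_group m_assoc)
  then show ?thesis using h assms by (auto simp: conj_class_def)
qed

end

section \<open>Schur's theorem on multipliers\<close>

context central_S_ring_partition
begin

lemma eqv_conj_class:
  assumes "g \<in> carrier G" "c \<in> conj_class g" shows "c \<sim> g"
proof -
  obtain h where "h \<in> carrier G" "c = h \<otimes> g \<otimes> inv h"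
    using assms(2) by (auto simp: conj_class_def)
  then show ?thesis using eqv_conj[OF assms(1), of "inv h"] by simp
qed

lemma basic_set_subset: "X \<in> S \<Longrightarrow> X \<subseteq> carrier G"
  using partition_onD1[OF partition] by auto

lemma card_tuples_conj:
  assumes "X \<in> S" "g \<in> carrier G" "c \<in> conj_class g"
  shows "card (tuples X n c) = card (tuples X n g)"
  using eqv_imp_eq[OF card_tuples_in_ring[OF assms(1)] eqv_conj_class[OF assms(2,3)]] by simp

text \<open>
  Cyclic rotation acts on the \<open>r\<close>-tuples over \<open>X\<close> whose product lies in a
  conjugacy class, with the constant tuples as its fixed points.
\<close>

lemma card_tuples_cong:
  assumes X: "X \<in> S" and g: "g \<in> carrier G" and r: "prime r"
  shows "[card (conj_class g) * card (tuples X r g) = card {u \<in> X. u [^] r \<in> conj_class g}] (mod r)"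
proof -
  let ?C = "conj_class g"
  define T where "T = (\<Union>c\<in>?C. tuples X r c)"
  note XG = basic_set_subset[OF X]
  have finC: "finite ?C" by (simp add: conj_class_def finite_carrier)
  have T: "T = {xs. length xs = r \<and> set xs \<subseteq> X \<and> list_prod xs \<in> ?C}"
    by (auto simp: T_def tuples_def)
  have "card T = (\<Sum>c\<in>?C. card (tuples X r c))"
    unfolding T_def using finC finite_tuples[OF XG]
    by (intro card_UN_disjoint) (blast, blast, auto simp: tuples_def)
  also have "\<dots> = card ?C * card (tuples X r g)"
    using card_tuples_conj[OF X g] by simp
  finally have cardT: "card T = card ?C * card (tuples X r g)" .
  have "[card T = card {xs \<in> T. rotate1 xs = xs}] (mod r)"
  proof (rule card_cong_card_fixpoints)
    show "finite T" unfolding T_def using finC finite_tuples[OF XG] by blast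
    show "prime r" by fact
    show "rotate1 xs \<in> T" if "xs \<in> T" for xs
    proof (cases xs)
      case (Cons x ys)
      have in_G: "x \<in> carrier G" "set ys \<subseteq> carrier G" and p: "x \<otimes> list_prod ys \<in> ?C"
        using that XG Cons by (auto simp: T list_prod_Cons)
      \<comment> \<open>Rotation conjugates the product by the first entry, which is why
        \<open>T\<close> collects the tuples over a whole conjugacy class and not over one
        product.\<close>
      have "list_prod (rotate1 xs) = list_prod ys \<otimes> x"
        using in_G by (simp add: Cons list_prod_append list_prod_Cons) (simp add: list_prod_def)
      also have "\<dots> = inv x \<otimes> (x \<otimes> list_prod ys) \<otimes> x"
        using in_G list_prod_closed[of ys] by (simp add: m_assoc[symmetric])
      also have "\<dots> \<in> ?C" using conj_class_inv_conj[OF g p in_G(1)] .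
      finally show ?thesis using that by (simp add: T)
    qed (use that in simp)
    show "(rotate1 ^^ r) xs = xs" if "xs \<in> T" for xs
      using that rotate_id[of r xs] by (simp add: T rotate_def)
  qed
  also have "{xs \<in> T. rotate1 xs = xs} = replicate r ` {u \<in> X. u [^] r \<in> ?C}"
  proof (intro equalityI subsetI)
    fix xs assume xs: "xs \<in> {xs \<in> T. rotate1 xs = xs}"
    then have eq: "xs = replicate r (hd xs)"
      using nth_eq_hd_if_rotate1_fixed[of xs] by (intro nth_equalityI) (auto simp: T)
    have "xs \<noteq> []" using xs r by (auto simp: T)
    then have "hd xs \<in> X" using xs by (auto simp: T)
    moreover have "list_prod xs = hd xs [^] r"
      using list_prod_replicate[of "hd xs" r] eq \<open>hd xs \<in> X\<close> XG by auto
    ultimately show "xs \<in> replicate r ` {u \<in> X. u [^] r \<in> ?C}" using xs eq by (auto simp: T)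
  next
    fix xs assume "xs \<in> replicate r ` {u \<in> X. u [^] r \<in> ?C}"
    then obtain u where "u \<in> X" "u [^] r \<in> ?C" "xs = replicate r u" by blast
    moreover have "rotate1 (replicate r u) = replicate r u"
      by (cases r) (simp_all add: replicate_append_same)
    ultimately show "xs \<in> {xs \<in> T. rotate1 xs = xs}"
      using list_prod_replicate[of u r] XG by (auto simp: T)
  qed
  also have "card \<dots> = card {u \<in> X. u [^] r \<in> ?C}"
    using r by (intro card_image inj_onI) (auto simp: replicate_eq_replicate)
  finally show ?thesis using cardT by simp
qed

text \<open>Let \<open>X\<close> be the basic set of \<open>x\<close>. Up to a class size coprime to
  \<open>r\<close>, the number of \<open>r\<close>-tuples over \<open>X\<close> with product
  \<open>z [^] r\<close> is 1 or 0 modulo \<open>r\<close>, according as \<open>z\<close> lies in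
  \<open>X\<close> or not. This number agrees at \<open>x [^] r\<close> and \<open>y [^] r\<close>,
  so \<open>y\<close> lies in \<open>X\<close> as well.\<close>

lemma eqv_pow_prime_imp_eqv:
  assumes r: "prime r" "coprime r (order G)"
    and x: "x \<in> carrier G" and y: "y \<in> carrier G" and eqv: "x [^] r \<sim> y [^] r"
  shows "x \<sim> y"
proof -
  obtain X where X: "X \<in> S" "x \<in> X" using eqv_refl[OF x] by (auto simp: eqv_def)
  note XG = basic_set_subset[OF X(1)]
  have count: "[card (conj_class (z [^] r)) * card (tuples X r (z [^] r)) =
      (if z \<in> X then card (conj_class (z [^] r)) else 0)] (mod r)" if z: "z \<in> carrier G" for z
  proof -
    \<comment> \<open>Since \<open>r\<close>-th roots are unique, a root of a conjugate of
      \<open>z [^] r\<close> is the corresponding conjugate of \<open>z\<close>.\<close>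
    have root: "u \<in> conj_class z" if "u \<in> X" "u [^] r \<in> conj_class (z [^] r)" for u
    proof -
      obtain h where h: "h \<in> carrier G" "u [^] r = h \<otimes> z [^] r \<otimes> inv h"
        using \<open>u [^] r \<in> _\<close> by (auto simp: conj_class_def)
      then have "u [^] r = (h \<otimes> z \<otimes> inv h) [^] r" using z by (simp add: conj_pow)
      then have "u = h \<otimes> z \<otimes> inv h"
        using pow_inj_coprime[OF r(2), of u "h \<otimes> z \<otimes> inv h"] h(1) z subsetD[OF XG \<open>u \<in> X\<close>]
        by simp
      then show ?thesis using h by (auto simp: conj_class_def)
    qed
    have "card {u \<in> X. u [^] r \<in> conj_class (z [^] r)} =
      (if z \<in> X then card (conj_class (z [^] r)) else 0)"
    proof (cases "z \<in> X")
      case True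
      have in_X: "h \<otimes> z \<otimes> inv h \<in> X" if "h \<in> carrier G" for h
      proof -
        have "h \<otimes> z \<otimes> inv h \<sim> z"
          using eqv_conj_class[OF z] that by (simp add: conj_class_def)
        then show ?thesis using basic_set_eq[OF X(1) True] eqv_sym by blast
      qed
      \<comment> \<open>The \<open>r\<close>-th power map sends the roots bijectively to the class;
        it is onto because \<open>X\<close> contains all conjugates of \<open>z\<close>.\<close>
      have "(\<lambda>u. u [^] r) ` {u \<in> X. u [^] r \<in> conj_class (z [^] r)} = conj_class (z [^] r)"
      proof (intro equalityI subsetI)
        fix c assume c: "c \<in> conj_class (z [^] r)"
        then obtain h where h: "h \<in> carrier G" "c = h \<otimes> z [^] r \<otimes> inv h"
          by (auto simp: conj_class_def)
        then have "c = (h \<otimes> z \<otimes> inv h) [^] r" using z by (simp add: conj_pow)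
        then show "c \<in> (\<lambda>u. u [^] r) ` {u \<in> X. u [^] r \<in> conj_class (z [^] r)}"
          using in_X[OF h(1)] c by blast
      qed auto
      moreover have "inj_on (\<lambda>u. u [^] r) {u \<in> X. u [^] r \<in> conj_class (z [^] r)}"
        using pow_inj_coprime[OF r(2)] XG by (intro inj_onI) (simp add: subset_iff)
      ultimately show ?thesis
        using True card_image[of "\<lambda>u. u [^] r" "{u \<in> X. u [^] r \<in> conj_class (z [^] r)}"] by simp
    next
      case False
      have "u \<notin> conj_class z" if "u \<in> X" for u
        using eqv_conj_class[OF z] basic_set_eq[OF X(1) that] False by blast
      then have empty: "{u \<in> X. u [^] r \<in> conj_class (z [^] r)} = {}" using root by blast
      show ?thesis unfolding empty using False by simp
    qed
    then show ?thesis
      using card_tuples_cong[OF X(1) nat_pow_closed[OF z] r(1), of r] by simp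
  qed
  have cop: "coprime (card (conj_class (z [^] r))) r" if "z \<in> carrier G" for z
    using card_conj_class_dvd_order[of "z [^] r"] that r(2)
    by (metis coprime_commute coprime_divisors dvd_refl nat_pow_closed)
  have "\<not> r dvd card (conj_class (z [^] r))" if "z \<in> carrier G" for z
    using cop[OF that] r(1) by (metis coprime_absorb_right not_prime_unit)
  then have "\<not> r dvd card (tuples X r (x [^] r))"
    using count[OF x] X(2) x by (auto dest: cong_dvd_iff)
  moreover have "card (tuples X r (x [^] r)) = card (tuples X r (y [^] r))"
    using eqv_imp_eq[OF card_tuples_in_ring[OF X(1)] eqv] by simp
  ultimately have "\<not> r dvd card (conj_class (y [^] r)) * card (tuples X r (y [^] r))"
    using cop[OF y] by (simp add: coprime_commute coprime_dvd_mult_right_iff)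
  then have "y \<in> X" using count[OF y] by (auto simp: cong_0_iff split: if_splits)
  then show ?thesis using X by (auto simp: eqv_def)
qed

text \<open>The converse follows by going around the cycle of powers. With
  \<open>k = totient (order G) - 1\<close>, Euler's theorem gives
  \<open>(z [^] r) [^] (r ^ k) = z\<close>, so \<open>x \<sim> y\<close> is an equivalence between
  \<open>r ^ k\<close>-th powers of \<open>x [^] r\<close> and \<open>y [^] r\<close>, and the
  previous lemma removes one factor \<open>r\<close> at a time.\<close>

lemma eqv_pow_prime:
  assumes r: "prime r" "coprime r (order G)" and eqv: "x \<sim> y"
  shows "x [^] r \<sim> y [^] r"
proof -
  have xy: "x \<in> carrier G" "y \<in> carrier G" using eqv_carrier[OF eqv] by auto
  have iter: "x \<sim> y"
    if "x \<in> carrier G" "y \<in> carrier G" "x [^] (r ^ k) \<sim> y [^] (r ^ k)" for x y and k :: nat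
    using that
  proof (induction k arbitrary: x y)
    case (Suc k)
    then have "(x [^] r) [^] (r ^ k) \<sim> (y [^] r) [^] (r ^ k)" by (simp add: nat_pow_pow)
    with Suc have "x [^] r \<sim> y [^] r" by simp
    with Suc.prems show ?case using eqv_pow_prime_imp_eqv[OF r] by simp
  qed simp
  have pos: "order G > 0" using finite_carrier by (simp add: order_gt_0_iff_finite)
  define k where "k = totient (order G) - 1"
  have "r * r ^ k = r ^ totient (order G)"
    using pos by (simp add: k_def flip: power_Suc)
  then have "[r * r ^ k = 1] (mod order G)" using euler_theorem[OF r(2)] by simp
  then have "(z [^] r) [^] (r ^ k) = z" if "z \<in> carrier G" for z
    using pow_cong[OF that pow_order_eq_1[OF that], of "r * r ^ k" 1] that by (simp add: nat_pow_pow)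
  then show ?thesis using iter[of "x [^] r" "y [^] r" k] xy eqv by simp
qed

text \<open>Power maps compose, so the exponent is built up from its prime factors, each coprime to
  the group order.\<close>

theorem eqv_pow:
  assumes "coprime m (order G)" "x \<sim> y"
  shows "x [^] m \<sim> y [^] m"
  using assms
proof (induction m arbitrary: x y rule: prime_divisors_induct)
  case zero
  then show ?case by (simp add: eqv_refl)
next
  case (unit m)
  then show ?case using eqv_carrier by auto
next
  case (factor r m)
  have "(x [^] r) [^] m \<sim> (y [^] r) [^] m"
    using factor by (simp add: eqv_pow_prime)
  then show ?case using eqv_carrier[OF factor.prems(2)] by (simp add: nat_pow_pow)
qed

end

section \<open>Automorphisms of the Cayley scheme and a criterion for being schurian\<close>

context central_S_ring_partition
begin

text \<open>
  The group witnessing that the ring is schurian: the automorphisms of the Cayley scheme, whose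
  relations are the sets of pairs with \<open>u \<otimes> inv v\<close> in a given basic set.
\<close>

definition scheme_auts :: "('a \<Rightarrow> 'a) set" where
  "scheme_auts = {f \<in> Bij (carrier G).
     \<forall>u\<in>carrier G. \<forall>v\<in>carrier G. f u \<otimes> inv (f v) \<sim> u \<otimes> inv v}"

lemma subgroup_scheme_auts: "subgroup scheme_auts (BijGroup (carrier G))"
proof (rule group.subgroupI[OF group_BijGroup])
  show "scheme_auts \<subseteq> carrier (BijGroup (carrier G))"
    by (auto simp: scheme_auts_def BijGroup_def)
  have "(\<lambda>x\<in>carrier G. x) \<in> scheme_auts"
    by (simp add: scheme_auts_def id_Bij eqv_refl)
  then show "scheme_auts \<noteq> {}" by blast
next
  fix f assume f: "f \<in> scheme_auts"
  then have bij: "f \<in> Bij (carrier G)" by (simp add: scheme_auts_def)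
  have inv_f: "f (inv_into (carrier G) f u) = u" if "u \<in> carrier G" for u
    using bij that by (simp add: Bij_def bij_betw_def f_inv_into_f)
  have "inv_into (carrier G) f u \<otimes> inv (inv_into (carrier G) f v) \<sim> u \<otimes> inv v"
    if "u \<in> carrier G" "v \<in> carrier G" for u v
  proof -
    have "f (inv_into (carrier G) f u) \<otimes> inv (f (inv_into (carrier G) f v)) \<sim>
      inv_into (carrier G) f u \<otimes> inv (inv_into (carrier G) f v)"
      using f that bij by (simp add: scheme_auts_def Bij_inv_into_mem)
    then show ?thesis using inv_f that eqv_sym by simp
  qed
  then show "inv\<^bsub>BijGroup (carrier G)\<^esub> f \<in> scheme_auts"
    using bij by (simp add: inv_BijGroup scheme_auts_def restrict_inv_into_Bij)
next
  fix f g assume f: "f \<in> scheme_auts" and g: "g \<in> scheme_auts"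
  then have bij: "f \<in> Bij (carrier G)" "g \<in> Bij (carrier G)" by (auto simp: scheme_auts_def)
  have "f (g u) \<otimes> inv (f (g v)) \<sim> u \<otimes> inv v" if "u \<in> carrier G" "v \<in> carrier G" for u v
  proof -
    have "g u \<in> carrier G" "g v \<in> carrier G"
      using bij that by (auto dest!: Bij_imp_funcset)
    then have "f (g u) \<otimes> inv (f (g v)) \<sim> g u \<otimes> inv (g v)" using f by (simp add: scheme_auts_def)
    moreover have "g u \<otimes> inv (g v) \<sim> u \<otimes> inv v" using g that by (simp add: scheme_auts_def)
    ultimately show ?thesis by (rule eqv_trans)
  qed
  then show "f \<otimes>\<^bsub>BijGroup (carrier G)\<^esub> g \<in> scheme_auts"
    using bij by (simp add: BijGroup_def scheme_auts_def compose_Bij compose_eq)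
qed

lemma right_translation_scheme_aut:
  assumes "g \<in> carrier G"
  shows "(\<lambda>x \<in> carrier G. x \<otimes> g) \<in> scheme_auts"
proof -
  have "bij_betw (\<lambda>x \<in> carrier G. x \<otimes> g) (carrier G) (carrier G)"
    by (rule bij_betwI[where g = "\<lambda>x. x \<otimes> inv g"]) (use assms in \<open>auto simp: m_assoc\<close>)
  moreover have "u \<otimes> g \<otimes> inv (v \<otimes> g) = u \<otimes> inv v" if "u \<in> carrier G" "v \<in> carrier G" for u v
  proof -
    have "u \<otimes> g \<otimes> inv (v \<otimes> g) = u \<otimes> (g \<otimes> inv g) \<otimes> inv v"
      using that assms by (simp only: inv_mult_group m_assoc m_closed inv_closed)
    then show ?thesis using that assms by simp
  qed
  ultimately show ?thesis by (simp add: scheme_auts_def Bij_def eqv_refl)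
qed

text \<open>An automorphism fixing \<open>\<one>\<close> preserves every basic set, as seen by
  comparing \<open>x\<close> with \<open>\<one>\<close>, so only transitivity on basic sets has to
  be supplied. Bijectivity of \<open>f\<close> comes for free: \<open>f u = f v\<close> makes
  \<open>u \<otimes> inv v\<close> equivalent to \<open>\<one>\<close>, whose basic set is a
  singleton, and the carrier is finite.\<close>

lemma schurianI:
  assumes "\<And>x y. x \<sim> y \<Longrightarrow> \<exists>f \<in> carrier G \<rightarrow> carrier G.
    (\<forall>u\<in>carrier G. \<forall>v\<in>carrier G. f u \<otimes> inv (f v) \<sim> u \<otimes> inv v) \<and> f \<one> = \<one> \<and> f x = y"
  shows "schurian G A"
proof -
  have orbit: "{f x | f. f \<in> scheme_auts \<and> f \<one> = \<one>} = {y. x \<sim> y}" if x: "x \<in> carrier G" for x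
  proof (intro equalityI subsetI)
    fix y assume "y \<in> {f x | f. f \<in> scheme_auts \<and> f \<one> = \<one>}"
    then obtain f where f: "f \<in> scheme_auts" "f \<one> = \<one>" "y = f x" by blast
    then have "f x \<otimes> inv (f \<one>) \<sim> x \<otimes> inv \<one>"
      using x unfolding scheme_auts_def by blast
    moreover have "f x \<in> carrier G"
      using f(1) x Bij_imp_funcset by (fastforce simp: scheme_auts_def)
    ultimately show "y \<in> {y. x \<sim> y}" using f x eqv_sym by simp
  next
    fix y assume "y \<in> {y. x \<sim> y}"
    then obtain f where f: "f \<in> carrier G \<rightarrow> carrier G" "f \<one> = \<one>" "f x = y"
      and rel: "\<And>u v. u \<in> carrier G \<Longrightarrow> v \<in> carrier G \<Longrightarrow> f u \<otimes> inv (f v) \<sim> u \<otimes> inv v"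
      using assms[of x y] by auto
    have "inj_on f (carrier G)"
    proof (rule inj_onI)
      fix u v assume uv: "u \<in> carrier G" "v \<in> carrier G" "f u = f v"
      then have "f v \<in> carrier G" using f(1) by auto
      then have "\<one> \<sim> u \<otimes> inv v" using rel[OF uv(1,2)] uv(3) by simp
      then have "u \<otimes> inv v = \<one>" using eqv_one eqv_sym by blast
      then show "u = v" using uv by (metis inv_equality inv_inv inv_closed)
    qed
    then have "f ` carrier G = carrier G"
      using f(1) finite_carrier by (intro endo_inj_surj) auto
    then have "bij_betw (restrict f (carrier G)) (carrier G) (carrier G)"
      using \<open>inj_on f (carrier G)\<close> by (simp add: bij_betw_def)
    then have "restrict f (carrier G) \<in> scheme_auts"
      using rel by (simp add: scheme_auts_def Bij_def)
    moreover have "restrict f (carrier G) \<one> = \<one>" "restrict f (carrier G) x = y"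
      using f x by auto
    ultimately show "y \<in> {f x | f. f \<in> scheme_auts \<and> f \<one> = \<one>}" by blast
  qed
  have "S = {{y. x \<sim> y} | x. x \<in> carrier G}"
  proof (intro equalityI subsetI)
    fix X assume X: "X \<in> S"
    then obtain x where "x \<in> X" using partition_onD3[OF partition] by (metis ex_in_conv)
    then show "X \<in> {{y. x \<sim> y} | x. x \<in> carrier G}"
      using basic_set_eq[OF X] basic_set_subset[OF X] by auto
  next
    fix X assume "X \<in> {{y. x \<sim> y} | x. x \<in> carrier G}"
    then obtain x where "x \<in> carrier G" "X = {y. x \<sim> y}" by blast
    moreover obtain Y where "Y \<in> S" "x \<in> Y"
      using partition_onD1[OF partition] \<open>x \<in> carrier G\<close> by auto
    ultimately show "X \<in> S" using basic_set_eq by simp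
  qed
  also have "\<dots> = {{f x | f. f \<in> scheme_auts \<and> f \<one> = \<one>} | x. x \<in> carrier G}"
    using orbit by auto
  finally have S: "S = \<dots>" .
  have "{{f x | f. f \<in> scheme_auts \<and> f \<one> = \<one>} | x. x \<in> carrier G} =
    orbits (BijGroup (carrier G)
      \<lparr>carrier := stabilizer (BijGroup (carrier G)\<lparr>carrier := scheme_auts\<rparr>) (\<lambda>f. f) \<one>\<rparr>)
      (carrier G) (\<lambda>f. f)"
    by (simp add: orbits_def orbit_def stabilizer_def)
  with S have "S = orbits (BijGroup (carrier G)
      \<lparr>carrier := stabilizer (BijGroup (carrier G)\<lparr>carrier := scheme_auts\<rparr>) (\<lambda>f. f) \<one>\<rparr>)
      (carrier G) (\<lambda>f. f)"
    by (rule trans)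
  then show ?thesis
    using basic subgroup_scheme_auts right_translation_scheme_aut unfolding schurian_def by blast
qed

end

section \<open>Elements with a prime power map into a subgroup\<close>

context group
begin

lemma subgroup_pow_closed:
  assumes "subgroup N G" "y \<in> N" shows "y [^] (k::nat) \<in> N"
proof -
  interpret subgroup N G by fact
  show ?thesis by (induction k) (use assms in auto)
qed

text \<open>As \<open>r\<close> and \<open>d\<close> are coprime, Bezout expresses \<open>y\<close>
  through powers of \<open>y [^] r\<close> and \<open>y [^] d\<close>.\<close>

lemma subgroup_pow_prime_imp_mem:
  assumes N: "subgroup N G" and y: "y \<in> carrier G"
    and r: "prime r" "y [^] r \<in> N" and d: "\<not> r dvd d" "y [^] (d::nat) \<in> N"
  shows "y \<in> N"
proof -
  have "coprime r d" using prime_imp_coprime[OF r(1) d(1)] .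
  moreover have "d \<noteq> 0" using d(1) by (metis dvd_0_right)
  ultimately obtain a b where ab: "d * a = r * b + 1"
    using bezout_nat[of d r] by (metis coprime_commute coprime_imp_gcd_eq_1)
  interpret subgroup N G by fact
  have "(y [^] d) [^] a = (y [^] r) [^] b \<otimes> y"
    using y ab by (simp add: nat_pow_pow)
  moreover have "(y [^] d) [^] a \<in> N" "(y [^] r) [^] b \<in> N"
    using subgroup_pow_closed[OF N] r d by auto
  ultimately have "inv ((y [^] r) [^] b) \<otimes> ((y [^] r) [^] b \<otimes> y) \<in> N"
    by (metis m_closed m_inv_closed)
  then show ?thesis using y by (simp add: m_assoc[symmetric])
qed

text \<open>The cosets of \<open>N\<close> by the first \<open>r\<close> powers of \<open>y\<close>
  are distinct, since a coincidence would put a power of \<open>y\<close> with exponent prime to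
  \<open>r\<close> into \<open>N\<close>. This serves the normality of the subgroup of order
  \<open>q\<close>, the coordinates on the whole group, and, with the trivial subgroup, the
  generation of \<open>N\<close> by one element.\<close>

lemma inj_on_subgroup_mult_pow:
  assumes N: "subgroup N G" and y: "y \<in> carrier G" "y \<notin> N"
    and r: "prime r" "y [^] (r::nat) \<in> N"
  shows "inj_on (\<lambda>(a, i). a \<otimes> y [^] i) (N \<times> {..<r})"
proof -
  interpret subgroup N G by fact
  have le: "i = j \<and> a = b"
    if ab: "a \<in> N" "b \<in> N" and eq: "a \<otimes> y [^] i = b \<otimes> y [^] j" and "i \<le> j" "j < r" for a b i j
  proof -
    have "y [^] j = y [^] (j - i) \<otimes> y [^] i" using y(1) \<open>i \<le> j\<close> by (simp add: nat_pow_mult)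
    then have "a \<otimes> y [^] i = (b \<otimes> y [^] (j - i)) \<otimes> y [^] i"
      using eq ab y by (simp add: m_assoc)
    then have a: "a = b \<otimes> y [^] (j - i)" using ab y right_cancel by simp
    then have "y [^] (j - i) = inv b \<otimes> a" using ab y by (simp add: inv_solve_left)
    then have "y [^] (j - i) \<in> N" using ab by simp
    then have "r dvd j - i" using subgroup_pow_prime_imp_mem[OF N y(1) r] y(2) by blast
    then have "i = j"
      using that by (meson dvd_imp_le le_antisym diff_is_0_eq less_imp_diff_less not_le zero_less_diff)
    then show ?thesis using a ab by simp
  qed
  show ?thesis
  proof (rule inj_onI, clarsimp)
    fix a i b j
    assume "a \<in> N" "b \<in> N" "i < r" "j < r" "a \<otimes> y [^] i = b \<otimes> y [^] j"
    then show "a = b \<and> i = j"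
      using le[of a b i j] le[of b a j i] by (cases "i \<le> j") auto
  qed
qed

lemma subgroup_pow_card_eq_one:
  assumes "subgroup N G" "y \<in> N" shows "y [^] card N = \<one>"
  using group.pow_order_eq_1[OF subgroup.subgroup_is_group[OF assms(1) is_group], of y] assms(2)
  by (simp add: order_def nat_pow_consistent[symmetric])

end

section \<open>Structure of the nonabelian group of order \<open>p * q\<close>\<close>

locale nonabelian_order_pq = group G for G (structure) +
  fixes p q :: nat and N :: "'a set"
  assumes prime_p: "prime p" and prime_q: "prime q" and p_less_q: "p < q"
    and order: "order G = p * q" and nonabelian: "\<not> comm_group G"
    and subgroup_N: "subgroup N G" and card_N: "card N = q"
begin

sublocale subgroup N G by (rule subgroup_N)

lemma finite_G: "finite (carrier G)"
  using order prime_p prime_q by (simp add: order_gt_0_iff_finite[symmetric] prime_gt_0_nat)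

lemma finite_N: "finite N"
  using finite_G subset by (rule rev_finite_subset)

lemma pow_q: "a \<in> N \<Longrightarrow> a [^] q = \<one>"
  using subgroup_pow_card_eq_one[OF subgroup_N] card_N by simp

text \<open>
  A conjugate of an element of \<open>N\<close> outside \<open>N\<close> would give \<open>q * q > p * q\<close> elements.
\<close>

lemma normal_N: "N \<lhd> G"
  unfolding normal_inv_iff
proof (intro conjI ballI subgroup_N)
  fix x n assume x: "x \<in> carrier G" and n: "n \<in> N"
  let ?m = "x \<otimes> n \<otimes> inv x"
  show "?m \<in> N"
  proof (rule ccontr)
    assume "?m \<notin> N"
    moreover have "?m [^] q = \<one>" using x n pow_q by (simp add: conj_pow)
    ultimately have "inj_on (\<lambda>(a, i). a \<otimes> ?m [^] i) (N \<times> {..<q})"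
      using x n prime_q by (intro inj_on_subgroup_mult_pow subgroup_N) auto
    moreover have "(\<lambda>(a, i). a \<otimes> ?m [^] i) ` (N \<times> {..<q}) \<subseteq> carrier G"
      using x n by auto
    ultimately have "card (N \<times> {..<q}) \<le> order G"
      unfolding order_def using finite_G by (metis card_image card_mono)
    then show False using card_N order p_less_q by (simp add: card_cartesian_product)
  qed
qed

lemma conj_in_N: "x \<in> carrier G \<Longrightarrow> n \<in> N \<Longrightarrow> x \<otimes> n \<otimes> inv x \<in> N"
  using normal_N by (simp add: normal_inv_iff)

text \<open>The quotient by \<open>N\<close> has order \<open>p\<close>, so the \<open>p\<close>-th
  power of each coset is trivial.\<close>

lemma pow_p_in_N:
  assumes y: "y \<in> carrier G" shows "y [^] p \<in> N"
proof -
  interpret normal N G by (rule normal_N)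
  have "card (rcosets N) * q = p * q"
    using lagrange_finite[OF finite_G subgroup_N] card_N order by simp
  then have "Coset.order (G Mod N) = p"
    using prime_q by (simp add: order_def FactGroup_def prime_gt_0_nat)
  moreover have "N #> y \<in> carrier (G Mod N)" using y by (auto simp: FactGroup_def RCOSETS_def)
  ultimately have "(N #> y) [^]\<^bsub>G Mod N\<^esub> p = \<one>\<^bsub>G Mod N\<^esub>"
    using group.pow_order_eq_1[OF factorgroup_is_group] by metis
  then have "N #> y [^] p = N" using FactGroup_pow[OF y, of p] by (simp add: FactGroup_def)
  then show ?thesis using coset_join1 y subgroup_N by simp
qed

text \<open>Injectivity together with the count \<open>q * p\<close> leaves no element out. The
  pairs \<open>(a, i)\<close> serve as coordinates on the group from here on.\<close>

lemma coset_representation: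
  assumes y: "y \<in> carrier G" "y \<notin> N"
  shows "bij_betw (\<lambda>(a, i). a \<otimes> y [^] i) (N \<times> {..<p}) (carrier G)"
proof -
  have inj: "inj_on (\<lambda>(a, i). a \<otimes> y [^] i) (N \<times> {..<p})"
    using inj_on_subgroup_mult_pow[OF subgroup_N y prime_p pow_p_in_N[OF y(1)]] .
  have "(\<lambda>(a, i). a \<otimes> y [^] i) ` (N \<times> {..<p}) \<subseteq> carrier G" using y by auto
  moreover have "card ((\<lambda>(a, i). a \<otimes> y [^] i) ` (N \<times> {..<p})) = card (carrier G)"
    using card_image[OF inj] card_N order by (simp add: card_cartesian_product order_def)
  ultimately show ?thesis using inj finite_G by (simp add: bij_betw_def card_subset_eq)
qed

lemma coset_representationE:
  assumes "y \<in> carrier G" "y \<notin> N" "u \<in> carrier G"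
  obtains a i where "a \<in> N" "i < p" "u = a \<otimes> y [^] i"
proof -
  have "u \<in> (\<lambda>(a, i). a \<otimes> y [^] i) ` (N \<times> {..<p})"
    using bij_betw_imp_surj_on[OF coset_representation[OF assms(1,2)]] assms(3) by simp
  then show ?thesis using that by auto
qed

text \<open>The first \<open>q\<close> powers of \<open>x\<close> are distinct, so they exhaust the
  \<open>q\<close> elements of \<open>N\<close>.\<close>

lemma N_powers:
  assumes "x \<in> N" "x \<noteq> \<one>" "a \<in> N"
  obtains i where "a = x [^] (i::nat)"
proof -
  have "inj_on (\<lambda>(a, i). a \<otimes> x [^] i) ({\<one>} \<times> {..<q})"
    using assms prime_q pow_q by (intro inj_on_subgroup_mult_pow triv_subgroup) auto
  then have "inj_on (\<lambda>i. x [^] i) {..<q}"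
    using assms(1) by (auto simp: inj_on_def)
  then have "card ((\<lambda>i. x [^] i) ` {..<q}) = card N" by (simp add: card_image card_N)
  moreover have "(\<lambda>i. x [^] i) ` {..<q} \<subseteq> N"
    using subgroup_pow_closed[OF subgroup_N assms(1)] by auto
  ultimately have "(\<lambda>i. x [^] i) ` {..<q} = N" using finite_N by (simp add: card_subset_eq)
  then show ?thesis using assms(3) that by auto
qed

lemma N_comm:
  assumes "a \<in> N" "b \<in> N" shows "a \<otimes> b = b \<otimes> a"
proof (cases "a = \<one>")
  case False
  then obtain i where "b = a [^] (i::nat)" using N_powers assms by blast
  then show ?thesis using group_commutes_pow[of a a i] assms by simp
qed (use assms in simp)

text \<open>A nontrivial \<open>n\<close> generates \<open>N\<close>, so \<open>y\<close> would
  commute with all of \<open>N\<close>. Since \<open>N\<close> is abelian and every element has the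
  form \<open>a \<otimes> y [^] i\<close>, the whole group would be commutative.\<close>

lemma centralizer_N:
  assumes y: "y \<in> carrier G" "y \<notin> N" and n: "n \<in> N" and comm: "n \<otimes> y = y \<otimes> n"
  shows "n = \<one>"
proof (rule ccontr)
  assume n1: "n \<noteq> \<one>"
  have comm_y: "a \<otimes> y [^] i = y [^] i \<otimes> a" if a: "a \<in> N" for a and i :: nat
  proof -
    obtain j where j: "a = n [^] (j::nat)" using N_powers[OF n n1 a] .
    have "a \<otimes> y = y \<otimes> a" unfolding j using comm n y by (intro group_commutes_pow) auto
    then show ?thesis using group_commutes_pow[of y a i] a y by simp
  qed
  have "u \<otimes> v = v \<otimes> u" if uv: "u \<in> carrier G" "v \<in> carrier G" for u v
  proof -
    obtain a i where u: "a \<in> N" "u = a \<otimes> y [^] (i::nat)" using coset_representationE[OF y uv(1)] .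
    obtain b j where v: "b \<in> N" "v = b \<otimes> y [^] (j::nat)" using coset_representationE[OF y uv(2)] .
    have "u \<otimes> v = a \<otimes> (y [^] i \<otimes> b) \<otimes> y [^] j" using u v y by (simp add: m_assoc)
    also have "\<dots> = (a \<otimes> b) \<otimes> (y [^] i \<otimes> y [^] j)"
      using u v y by (simp add: comm_y[OF v(1), symmetric] m_assoc)
    also have "\<dots> = (b \<otimes> a) \<otimes> (y [^] j \<otimes> y [^] i)"
      using N_comm[OF u(1) v(1)] y by (simp add: nat_pow_mult add.commute)
    also have "\<dots> = b \<otimes> (a \<otimes> y [^] j) \<otimes> y [^] i" using u v y by (simp add: m_assoc)
    also have "\<dots> = v \<otimes> u" using u v y by (simp add: comm_y[OF u(1)] m_assoc)
    finally show ?thesis .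
  qed
  then show False using nonabelian group_comm_groupI by blast
qed

text \<open>The power \<open>y [^] p\<close> lies in \<open>N\<close> and commutes with
  \<open>y\<close>, so \<open>centralizer_N\<close> applies to it.\<close>

lemma pow_p:
  assumes "y \<in> carrier G" "y \<notin> N" shows "y [^] p = \<one>"
  using centralizer_N[OF assms pow_p_in_N[OF assms(1)]] group_commutes_pow[of y y p] assms by simp

lemma pow_notin_N:
  assumes "y \<in> carrier G" "y \<notin> N" "\<not> p dvd i" shows "y [^] i \<notin> N"
  using subgroup_pow_prime_imp_mem[OF subgroup_N assms(1) prime_p pow_p_in_N[OF assms(1)] assms(3)]
    assms(2) by blast

text \<open>Conjugating \<open>y\<close> by \<open>n\<close> in \<open>N\<close> multiplies it on
  the left by an element \<open>f n\<close> of \<open>N\<close>. If \<open>f n = f m\<close>, then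
  \<open>inv m \<otimes> n\<close> centralizes \<open>y\<close> and is trivial; so \<open>f\<close>
  is injective on the finite set \<open>N\<close> and hits every \<open>a\<close>.\<close>

lemma coset_subset_conj_class:
  assumes y: "y \<in> carrier G" "y \<notin> N" and a: "a \<in> N"
  shows "a \<otimes> y \<in> conj_class y"
proof -
  define f where "f n = n \<otimes> (y \<otimes> inv n \<otimes> inv y)" for n
  have f_y: "f n \<otimes> y = n \<otimes> y \<otimes> inv n" if "n \<in> N" for n
    using that y by (simp add: f_def m_assoc)
  have "inj_on f N"
  proof (rule inj_onI)
    fix n m assume nm: "n \<in> N" "m \<in> N" "f n = f m"
    then have eq: "n \<otimes> y \<otimes> inv n = m \<otimes> y \<otimes> inv m" using f_y by metis
    have "inv m \<otimes> (n \<otimes> y \<otimes> inv n) \<otimes> n = inv m \<otimes> (m \<otimes> y \<otimes> inv m) \<otimes> n"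
      by (simp only: eq)
    then have "(inv m \<otimes> n) \<otimes> y = y \<otimes> (inv m \<otimes> n)"
      using nm(1,2) y by (simp add: m_assoc) (simp add: m_assoc[symmetric])
    then have "inv m \<otimes> n = \<one>" using centralizer_N[OF y, of "inv m \<otimes> n"] nm by simp
    then show "n = m" using nm by (metis inv_equality inv_inv mem_carrier inv_closed)
  qed
  moreover have "f ` N \<subseteq> N" using conj_in_N[OF y(1)] by (auto simp: f_def)
  ultimately have "f ` N = N" using finite_N by (simp add: endo_inj_surj)
  with a obtain n where n: "n \<in> N" "f n = a" by (metis imageE)
  have "a \<otimes> y = n \<otimes> y \<otimes> inv n" using f_y[OF n(1)] n(2) by simp
  then show ?thesis using n(1) by (simp add: conj_class_def)
qed

end

section \<open>Central S-rings over the group of order \<open>p * q\<close>\<close>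

locale central_S_ring_pq = nonabelian_order_pq G p q N + central_S_ring_partition G A S
  for G (structure) and p q N A S
begin

text \<open>Normality of \<open>N\<close> moves \<open>b\<close> to the left of \<open>y\<close>,
  and the coset of \<open>y\<close> lies in one conjugacy class.\<close>

lemma eqv_coset:
  assumes "y \<in> carrier G" "y \<notin> N" "a \<in> N" "b \<in> N"
  shows "a \<otimes> y \<otimes> b \<sim> y"
proof -
  have "a \<otimes> y \<otimes> b = (a \<otimes> (y \<otimes> b \<otimes> inv y)) \<otimes> y" using assms by (simp add: m_assoc)
  then show ?thesis
    using eqv_conj_class coset_subset_conj_class assms conj_in_N by (metis m_closed)
qed

text \<open>The Chinese remainder theorem combines nonzero residues into an exponent coprime to the
  group order, to which the theorem on multipliers applies. Powers of elements inside and outside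
  \<open>N\<close> can thus be prescribed independently.\<close>

lemma eqv_pow_crt:
  assumes "x \<sim> y" "\<not> p dvd i" "\<not> q dvd j"
  obtains m where "[m = i] (mod p)" "[m = j] (mod q)" "x [^] m \<sim> y [^] (m::nat)"
proof -
  have "coprime p q" using prime_p prime_q p_less_q by (simp add: primes_coprime)
  then obtain m where m: "[m = i] (mod p)" "[m = j] (mod q)"
    using binary_chinese_remainder_nat by blast
  have "\<not> p dvd m" "\<not> q dvd m" using m assms cong_dvd_iff by blast+
  then have "coprime p m" "coprime q m" using prime_p prime_q by (simp_all add: prime_imp_coprime)
  then have "coprime m (order G)" by (simp add: order coprime_commute)
  then show ?thesis using that m eqv_pow assms(1) by blast
qed

lemma one_not_dvd: "\<not> p dvd 1" "\<not> q dvd 1"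
  using prime_p prime_q by auto

text \<open>
  Exponents that are 1 modulo \<open>p\<close> move only the element of \<open>N\<close>, and those that are
  1 modulo \<open>q\<close> move only the element outside.
\<close>

lemma eqv_all_if_mixed:
  assumes x: "x \<in> N" "x \<noteq> \<one>" and y: "y \<in> carrier G" "y \<notin> N" and xy: "x \<sim> y"
    and z: "z \<in> carrier G" "z \<noteq> \<one>"
  shows "z \<sim> y"
proof (cases "z \<in> N")
  case True
  obtain j where j: "z = x [^] (j::nat)" using N_powers[OF x True] .
  have "\<not> q dvd j"
    using pow_q[OF x(1)] z(2) j x pow_cong[of x q j 0] by (auto simp: cong_0_iff)
  then obtain m where m: "[m = 1] (mod p)" "[m = j] (mod q)" "x [^] m \<sim> y [^] m"
    using eqv_pow_crt[OF xy one_not_dvd(1)] by blast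
  then have "y [^] m = y" "x [^] m = z"
    using pow_cong[OF y(1) pow_p[OF y] m(1)] pow_cong[OF _ pow_q[OF x(1)] m(2)] x j y by simp_all
  then show ?thesis using m by simp
next
  case False
  obtain a i where ai: "a \<in> N" "i < p" "z = a \<otimes> y [^] i" using coset_representationE[OF y z(1)] .
  then have "\<not> p dvd i" using False by (auto dest: dvd_imp_le)
  then obtain m where m: "[m = i] (mod p)" "[m = 1] (mod q)" "x [^] m \<sim> y [^] m"
    using eqv_pow_crt[OF xy _ one_not_dvd(2)] by blast
  then have "y [^] m = y [^] i" "x [^] m = x"
    using pow_cong[OF y(1) pow_p[OF y] m(1)] pow_cong[OF _ pow_q[OF x(1)] m(2)] x y by simp_all
  then have 1: "x \<sim> y [^] i" using m by simp
  have "z \<sim> y [^] i"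
    using eqv_coset[of "y [^] i" a \<one>] ai y pow_notin_N[OF y \<open>\<not> p dvd i\<close>] by simp
  then show ?thesis using 1 xy eqv_sym eqv_trans by blast
qed

text \<open>All nontrivial elements are equivalent, so every injective map of the carrier into
  itself preserves the relations; the transposition of \<open>u\<close> and \<open>v\<close> is
  enough.\<close>

lemma schurian_if_mixed:
  assumes "x \<in> N" "x \<noteq> \<one>" "y \<in> carrier G" "y \<notin> N" "x \<sim> y"
  shows "schurian G A"
proof (rule schurianI)
  note all = eqv_all_if_mixed[OF assms]
  have all2: "u \<sim> v" if "u \<in> carrier G" "v \<in> carrier G" "u \<noteq> \<one>" "v \<noteq> \<one>" for u v
    using all that eqv_sym eqv_trans by blast
  fix u v assume uv: "u \<sim> v"
  then have G: "u \<in> carrier G" "v \<in> carrier G" using eqv_carrier by auto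
  have one: "u = \<one> \<longleftrightarrow> v = \<one>" using uv eqv_one eqv_sym by blast
  define f where "f a = (if a = u then v else if a = v then u else a)" for a
  have f_G: "f a \<in> carrier G" if "a \<in> carrier G" for a using that G by (simp add: f_def)
  have inj: "f a = f b \<Longrightarrow> a = b" for a b by (auto simp: f_def split: if_splits)
  have ne: "a \<otimes> inv b \<noteq> \<one>" if "a \<in> carrier G" "b \<in> carrier G" "a \<noteq> b" for a b
    using that inv_equality[of a "inv b"] by auto
  have "f a \<otimes> inv (f b) \<sim> a \<otimes> inv b" if "a \<in> carrier G" "b \<in> carrier G" for a b
  proof (cases "a = b")
    case False
    then have "f a \<noteq> f b" using inj by blast
    then show ?thesis using False that f_G ne by (intro all2) simp_all
  qed (use f_G that eqv_refl in simp)
  moreover have "f \<one> = \<one>" "f u = v" using one by (auto simp: f_def)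
  ultimately show "\<exists>f \<in> carrier G \<rightarrow> carrier G.
      (\<forall>a\<in>carrier G. \<forall>b\<in>carrier G. f a \<otimes> inv (f b) \<sim> a \<otimes> inv b) \<and> f \<one> = \<one> \<and> f u = v"
    using f_G by (intro bexI[of _ f]) auto
qed

text \<open>Writing the inverse of \<open>z [^] j\<close> as \<open>z [^] (p - j)\<close> keeps all
  exponents natural numbers.\<close>

lemma pow_mult_inv_pow:
  assumes "z \<in> carrier G" "z [^] p = \<one>" "j < p"
  shows "z [^] (i::nat) \<otimes> inv (z [^] j) = z [^] (i + (p - j))"
proof -
  have "z [^] (p - j) \<otimes> z [^] j = \<one>" using assms by (simp add: nat_pow_mult)
  then have "inv (z [^] j) = z [^] (p - j)" using assms(1) by (intro inv_equality) auto
  then show ?thesis using assms(1) by (simp add: nat_pow_mult)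
qed

lemma N_pow_mult_inv:
  assumes "a \<in> N" "b \<in> N"
  shows "a [^] k \<otimes> inv (b [^] k) = (a \<otimes> inv b) [^] (k::nat)"
proof -
  have "a \<otimes> inv b = inv b \<otimes> a" using assms by (intro N_comm) auto
  then have "(a \<otimes> inv b) [^] k = a [^] k \<otimes> (inv b) [^] k"
    using pow_mult_distrib[of a "inv b" k] assms by simp
  then show ?thesis using assms by (simp add: nat_pow_inv)
qed

text \<open>If a quotient \<open>u \<otimes> inv v\<close> lies in \<open>N\<close>, the map raises
  it to the power \<open>k\<close>, which is harmless by assumption. Otherwise the quotient lies in
  the coset of some \<open>z [^] d\<close> and its image in that of \<open>z' [^] d\<close>; each
  coset is inside a basic set, and multipliers give \<open>z [^] d \<sim> z' [^] d\<close>.\<close>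

lemma exists_scheme_map:
  assumes z: "z \<in> carrier G" "z \<notin> N" and z': "z' \<in> carrier G" "z' \<notin> N"
    and zz': "z \<sim> z'" and k: "\<And>n. n \<in> N \<Longrightarrow> n [^] (k::nat) \<sim> n"
  obtains f where "f \<in> carrier G \<rightarrow> carrier G"
    "\<And>n i. n \<in> N \<Longrightarrow> i < p \<Longrightarrow> f (n \<otimes> z [^] i) = n [^] k \<otimes> z' [^] i"
    "\<forall>u\<in>carrier G. \<forall>v\<in>carrier G. f u \<otimes> inv (f v) \<sim> u \<otimes> inv v"
proof -
  note bij = coset_representation[OF z]
  define f where "f u = (case inv_into (N \<times> {..<p}) (\<lambda>(a, i). a \<otimes> z [^] i) u of
    (n, i) \<Rightarrow> n [^] k \<otimes> z' [^] i)" for u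
  have f: "f (n \<otimes> z [^] i) = n [^] k \<otimes> z' [^] i" if "n \<in> N" "i < p" for n i
    using bij_betw_inv_into_left[OF bij, of "(n, i)"] that by (simp add: f_def)
  have f_G: "f \<in> carrier G \<rightarrow> carrier G"
  proof
    fix u assume "u \<in> carrier G"
    then obtain n i where "n \<in> N" "i < p" "u = n \<otimes> z [^] i" using coset_representationE[OF z] by blast
    then show "f u \<in> carrier G" using f z' by simp
  qed
  have "f u \<otimes> inv (f v) \<sim> u \<otimes> inv v" if uv: "u \<in> carrier G" "v \<in> carrier G" for u v
  proof -
    obtain a i where a: "a \<in> N" "i < p" "u = a \<otimes> z [^] i" using coset_representationE[OF z uv(1)] .
    obtain b j where b: "b \<in> N" "j < p" "v = b \<otimes> z [^] j" using coset_representationE[OF z uv(2)] .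
    \<comment> \<open>Stated for an arbitrary base \<open>w\<close>, because it is used with
      \<open>z\<close> for the quotient and with \<open>z'\<close> for its image.\<close>
    have quot: "(c \<otimes> w [^] i) \<otimes> inv (d \<otimes> w [^] j) = c \<otimes> w [^] (i + (p - j)) \<otimes> inv d"
      if "c \<in> N" "d \<in> N" "w \<in> carrier G" "w \<notin> N" for c d w
    proof -
      have "(c \<otimes> w [^] i) \<otimes> inv (d \<otimes> w [^] j) = c \<otimes> (w [^] i \<otimes> inv (w [^] j)) \<otimes> inv d"
        using that by (simp add: inv_mult_group m_assoc)
      then show ?thesis using pow_mult_inv_pow[OF that(3) pow_p[OF that(3,4)] b(2)] by simp
    qed
    have uv_eq: "u \<otimes> inv v = a \<otimes> z [^] (i + (p - j)) \<otimes> inv b"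
      using quot[OF a(1) b(1) z] a b by simp
    have fuv_eq: "f u \<otimes> inv (f v) = a [^] k \<otimes> z' [^] (i + (p - j)) \<otimes> inv (b [^] k)"
      using quot[OF _ _ z', of "a [^] k" "b [^] k"] f a b subgroup_pow_closed[OF subgroup_N] by simp
    show ?thesis
    proof (cases "i = j")
      case True
      \<comment> \<open>For equal coordinates the middle exponent is \<open>p\<close> and not 0, so
        \<open>pow_p\<close> is what makes that factor vanish.\<close>
      then have "i + (p - j) = p" using a(2) by simp
      then have eqs: "u \<otimes> inv v = a \<otimes> inv b" "f u \<otimes> inv (f v) = (a \<otimes> inv b) [^] k"
        using uv_eq fuv_eq a(1) b(1) pow_p[OF z] pow_p[OF z'] N_pow_mult_inv[OF a(1) b(1), of k]
        by simp_all
      show ?thesis unfolding eqs by (rule k) (use a(1) b(1) in simp)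
    next
      case False
      define d where "d = i + (p - j)"
      \<comment> \<open>Since \<open>0 < d < 2 * p\<close>, divisibility by \<open>p\<close> would
        mean \<open>d = p\<close>, that is \<open>i = j\<close>.\<close>
      have "\<not> p dvd d"
      proof
        assume "p dvd d"
        then obtain c where c: "i + (p - j) = p * c" unfolding d_def by (elim dvdE)
        have "0 < p * c" "p * c < p * 2" using a(2) b(2) unfolding c[symmetric] by linarith+
        then have "c = 1" by simp
        then show False using c b(2) False by simp
      qed
      then have notin: "z [^] d \<notin> N" "z' [^] d \<notin> N" using pow_notin_N z z' by auto
      \<comment> \<open>The exponent \<open>d\<close> may be divisible by \<open>q\<close>; it is
        replaced by an \<open>m\<close> that is 1 modulo \<open>q\<close>, which does not change
        powers of elements of order \<open>p\<close>.\<close>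
      obtain m where m: "[m = d] (mod p)" "z [^] m \<sim> z' [^] m"
        using eqv_pow_crt[OF zz' \<open>\<not> p dvd d\<close> one_not_dvd(2)] .
      then have "z [^] d \<sim> z' [^] d"
        using pow_cong[OF z(1) pow_p[OF z] m(1)] pow_cong[OF z'(1) pow_p[OF z'] m(1)] by simp
      moreover have "u \<otimes> inv v \<sim> z [^] d"
        unfolding uv_eq d_def[symmetric] using notin a b z by (intro eqv_coset) auto
      moreover have "f u \<otimes> inv (f v) \<sim> z' [^] d"
        unfolding fuv_eq d_def[symmetric]
        using notin a b z' subgroup_pow_closed[OF subgroup_N] by (intro eqv_coset) auto
      ultimately show ?thesis using eqv_sym eqv_trans by blast
    qed
  qed
  then show ?thesis using that[OF f_G f] by simp
qed

text \<open>Each basic set now lies inside \<open>N\<close> or outside it. To move \<open>x\<close>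
  to \<open>y\<close> outside \<open>N\<close>, take \<open>k = 1\<close> and let the base change
  from \<open>x\<close> to \<open>y\<close>; inside \<open>N\<close>, keep a base outside
  \<open>N\<close> and take \<open>k\<close> with \<open>y = x [^] k\<close>.\<close>

lemma schurian_if_not_mixed:
  assumes unmixed: "\<And>x y. x \<in> N \<Longrightarrow> x \<noteq> \<one> \<Longrightarrow> y \<in> carrier G \<Longrightarrow> y \<notin> N \<Longrightarrow> \<not> x \<sim> y"
  shows "schurian G A"
proof (rule schurianI)
  fix x y assume xy: "x \<sim> y"
  then have G: "x \<in> carrier G" "y \<in> carrier G" using eqv_carrier by auto
  have one: "x = \<one> \<longleftrightarrow> y = \<one>" using xy eqv_one eqv_sym by blast
  have N: "x \<in> N \<longleftrightarrow> y \<in> N"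
    using unmixed[of x y] unmixed[of y x] xy eqv_sym one G by (metis one_closed)
  have p: "1 < p" using prime_gt_1_nat[OF prime_p] .
  show "\<exists>f \<in> carrier G \<rightarrow> carrier G.
    (\<forall>u\<in>carrier G. \<forall>v\<in>carrier G. f u \<otimes> inv (f v) \<sim> u \<otimes> inv v) \<and> f \<one> = \<one> \<and> f x = y"
  proof (cases "x \<in> N")
    case False
    have "n [^] (1::nat) \<sim> n" if "n \<in> N" for n using that eqv_refl by simp
    then obtain f where f: "f \<in> carrier G \<rightarrow> carrier G"
      "\<And>n i. n \<in> N \<Longrightarrow> i < p \<Longrightarrow> f (n \<otimes> x [^] i) = n [^] (1::nat) \<otimes> y [^] i"
      "\<forall>u\<in>carrier G. \<forall>v\<in>carrier G. f u \<otimes> inv (f v) \<sim> u \<otimes> inv v"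
      using exists_scheme_map[of x y 1] False G N xy by blast
    \<comment> \<open>The coordinates of \<open>\<one>\<close> and \<open>x\<close> are
      \<open>(\<one>, 0)\<close> and \<open>(\<one>, 1)\<close>; the second is admissible because
      \<open>1 < p\<close>.\<close>
    have "f \<one> = \<one>" "f x = y" using f(2)[of \<one> 0] f(2)[of \<one> 1] p G by simp_all
    then show ?thesis using f by blast
  next
    case x: True
    show ?thesis
    proof (cases "x = \<one>")
      case True
      then show ?thesis using one by (intro bexI[of _ "\<lambda>u. u"]) (auto simp: eqv_refl)
    next
      case False
      obtain k where k: "y = x [^] (k::nat)" using N_powers[OF x False] N x by blast
      \<comment> \<open>The single equivalence of \<open>x\<close> and \<open>x [^] k\<close>
        spreads over \<open>N\<close>: a nontrivial \<open>n\<close> is \<open>x [^] m\<close> with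
        \<open>m\<close> a multiplier, and raising both sides to the power \<open>m\<close> gives
        \<open>n\<close> and \<open>n [^] k\<close>.\<close>
      have powk: "n [^] k \<sim> n" if n: "n \<in> N" for n
      proof (cases "n = \<one>")
        case n1: False
        obtain j where j: "n = x [^] (j::nat)" using N_powers[OF x False n] .
        have "\<not> q dvd j"
          using pow_q[OF x] n1 j x pow_cong[of x q j 0] by (auto simp: cong_0_iff)
        then obtain m where m: "[m = j] (mod q)" "x [^] m \<sim> y [^] m"
          using eqv_pow_crt[OF xy one_not_dvd(1)] by blast
        then have n_eq: "n = x [^] m" using pow_cong[OF _ pow_q[OF x] m(1)] x j by simp
        have "y [^] m = n [^] k" using x by (simp add: k n_eq nat_pow_pow mult.commute)
        then show ?thesis using m(2) n_eq eqv_sym by simp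
      qed (simp add: eqv_refl)
      have "card N < card (carrier G)"
        using card_N order p prime_q by (simp add: order_def prime_gt_0_nat)
      then obtain z where z: "z \<in> carrier G" "z \<notin> N"
        using subset by (metis less_irrefl subsetI subset_antisym)
      obtain f where f: "f \<in> carrier G \<rightarrow> carrier G"
        "\<And>n i. n \<in> N \<Longrightarrow> i < p \<Longrightarrow> f (n \<otimes> z [^] i) = n [^] k \<otimes> z [^] i"
        "\<forall>u\<in>carrier G. \<forall>v\<in>carrier G. f u \<otimes> inv (f v) \<sim> u \<otimes> inv v"
        using exists_scheme_map[OF z z eqv_refl[OF z(1)] powk] by blast
      have "f \<one> = \<one>" "f x = y" using f(2)[of \<one> 0] f(2)[of x 0] p G x k by simp_all
      then show ?thesis using f by blast
    qed
  qed
qed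

theorem schurian: "schurian G A"
  using schurian_if_mixed schurian_if_not_mixed by blast

end

theorem corollary1p1:
  fixes G (structure) and p q :: nat
  assumes "prime p" and "prime q" and "[q = 1] (mod p)"
    and "group G" and "order G = p * q" and "\<not> comm_group G"
  shows "generalized_Schur G"
proof -
  interpret group G by fact
  have "p dvd q - 1" using assms(3) prime_gt_0_nat[OF assms(2)] by (simp add: cong_altdef_nat)
  then have "p < q"
    using prime_gt_1_nat[OF assms(2)] dvd_imp_le[of p "q - 1"] by simp
  have fin: "finite (carrier G)"
    using assms by (simp add: order_gt_0_iff_finite[symmetric] prime_gt_0_nat)
  \<comment> \<open>Sylow's theorem for the prime \<open>q\<close> and the factorization
    \<open>q ^ 1 * p\<close> of the order.\<close>
  obtain N where N: "subgroup N G" "card N = q"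
    using sylow_thm[OF assms(2,4) _ fin, of 1 p] assms(5) by (auto simp: mult.commute)
  show ?thesis
    unfolding generalized_Schur_def
  proof (intro allI impI)
    fix A assume A: "central_S_ring G A"
    then obtain S where "basic_sets G A S" by (auto simp: central_S_ring_def S_ring_def)
    then interpret central_S_ring_pq G p q N A S
      using A assms N fin \<open>p < q\<close>
      by (intro central_S_ring_pq.intro nonabelian_order_pq.intro nonabelian_order_pq_axioms.intro
          central_S_ring_partition.intro central_S_ring_partition_axioms.intro)
        (simp_all add: central_S_ring_def S_ring_def)
    show "schurian G A" by (rule schurian)
  qed
qed

end
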